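(* Let $*:\hat S\to\widehat{{}^*S}$ be an enlargement, let $\mathcal C$ and $\mathcal D$ be $\hat S$-small categories, and let $F:\mathcal C\to\mathcal D$ and $G:\mathcal D\to\mathcal C$ be two covariant functors. If $F$ is left adjoint to $G$, then ${}^*F:{}^*\mathcal C\to{}^*\mathcal D$ is left adjoint to ${}^*G:{}^*\mathcal D\to{}^*\mathcal C$.
   Context: Superstructures: a base set $S$ is an infinite set whose elements are not sets; $S_0=S$, $S_n=S_{n-1}\cup\mathcal P(S_{n-1})$, and $\hat S=\bigcup_{n\ge 0}S_n$. Formulas in $\hat S$ are built from $=$, $\in$, constants in $\hat S$, variables, ordered pairs and function application by $\neg$, $\wedge$ and bounded quantifiers $\forall x\in t$; statements are formulas without free variables. For $\varphi$ a formula in $\hat S$, ${}^*\varphi$ is obtained by replacing each constant $\tau$ by ${}^*\tau$. Enlargement: a map $*:\hat S\to\hat W$ between superstructures with (1) ${}^*S=W$; (2) ${}^*s=s$ for $s\in S$; (3) (transfer) a statement $\varphi$ in $\hat S$ is true iff ${}^*\varphi$ is true; (4) (saturation) with $\mathcal I=\bigcup_{A\in\hat S\setminus S}{}^*A$ (the internal elements), every nonempty family $\{U_i\}_{i\in I}$ of nonempty sets $U_i\in\mathcal I$ with $|I|\le|\hat S|$ and the finite intersection property has nonempty intersection. $\hat S$-small category: a category $\mathcal C=\langle M,s,t,c\rangle$ given by its set of morphisms $M\in\hat S\setminus S$, the maps $s,t:M\to M$ sending a morphism to the identity of its source resp. target, and the composition relation $c=\{\langle f,g,h\rangle: f\circ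 g=h\}$; objects are identified with their identity morphisms. Its enlargement is the category ${}^*\mathcal C=\langle{}^*M,{}^*s,{}^*t,{}^*c\rangle$. A functor $F$ between $\hat S$-small categories is a map on sets of morphisms compatible with $s,t,c$, hence an element of $\hat S$; ${}^*F$ is a functor between the enlarged categories. *)

theory Defs
  imports Main "HOL-Library.Equipollence"
begin

section \<open>The ambient set theory\<close>

text \<open>
  A superstructure has the size of an infinitely iterated power set, so no HOL type can be
  constructed that contains one. As superstructures live in set theory with non-set objects, the
  ambient universe is an arbitrary type satisfying Zermelo's axioms with urelements, with
  separation for arbitrary subsets in the sense of HOL. For a genuine superstructure over a set
  \<open>W\<close> of non-sets, these axioms hold, so nothing about superstructures is lost. No axiom of
  infinity is included here: \<open>base_set\<close> below requires an infinite set to exist.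
\<close>

class urelement_universe =
  fixes is_set :: "'a \<Rightarrow> bool"
    and elts :: "'a \<Rightarrow> 'a set"
  assumes elts_urelement: "\<not> is_set x \<Longrightarrow> elts x = {}"
    and extensionality: "is_set x \<Longrightarrow> is_set y \<Longrightarrow> elts x = elts y \<Longrightarrow> x = y"
    and separation: "A \<subseteq> elts x \<Longrightarrow> \<exists>y. is_set y \<and> elts y = A"
    and pairing: "\<exists>y. is_set y \<and> elts y = {a, b}"
    and union: "\<exists>y. is_set y \<and> elts y = (\<Union>z\<in>elts x. elts z)"
    and power_set: "\<exists>y. is_set y \<and> elts y = {z. is_set z \<and> elts z \<subseteq> elts x}"

text \<open>The object of the universe whose extension is \<open>A\<close>; meaningful only if there is one.\<close>

definition mk_set :: "'a::urelement_universe set \<Rightarrow> 'a" where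
  "mk_set A = (THE y. is_set y \<and> elts y = A)"

definition opair :: "'a::urelement_universe \<Rightarrow> 'a \<Rightarrow> 'a" where
  "opair a b = mk_set {mk_set {a}, mk_set {a, b}}"

definition otriple :: "'a::urelement_universe \<Rightarrow> 'a \<Rightarrow> 'a \<Rightarrow> 'a" where
  "otriple a b c = opair (opair a b) c"

text \<open>Function application is made total: the value is the empty set unless there is exactly one
  \<open>y\<close> with \<open>\<langle>x, y\<rangle> \<in> f\<close>.\<close>

definition app :: "'a::urelement_universe \<Rightarrow> 'a \<Rightarrow> 'a" where
  "app f x = (if \<exists>!y. opair x y \<in> elts f then THE y. opair x y \<in> elts f else mk_set {})"

definition is_fun :: "'a::urelement_universe \<Rightarrow> 'a \<Rightarrow> 'a \<Rightarrow> bool" where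
  "is_fun f A B \<longleftrightarrow> is_set f \<and> elts f \<subseteq> {opair x y | x y. x \<in> elts A \<and> y \<in> elts B} \<and>
     (\<forall>x\<in>elts A. \<exists>!y. opair x y \<in> elts f)"


section \<open>Superstructures\<close>

definition base_set :: "'a::urelement_universe set \<Rightarrow> bool" where
  "base_set S \<longleftrightarrow> infinite S \<and> (\<forall>s\<in>S. \<not> is_set s) \<and> (\<exists>x. is_set x \<and> elts x = S)"

primrec level :: "'a::urelement_universe set \<Rightarrow> nat \<Rightarrow> 'a set" where
  "level S 0 = S"
| "level S (Suc n) = level S n \<union> {x. is_set x \<and> elts x \<subseteq> level S n}"

definition superstructure :: "'a::urelement_universe set \<Rightarrow> 'a set" where
  "superstructure S = (\<Union>n. level S n)"


section \<open>Formulas\<close>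

datatype 'a tm =
    Const 'a
  | Var nat
  | Pair "'a tm" "'a tm"
  | App "'a tm" "'a tm"

text \<open>\<open>BAll x t \<phi>\<close> is \<open>\<forall>x\<in>t. \<phi>\<close>; occurrences of \<open>x\<close> in \<open>t\<close> are not bound by it.\<close>

datatype 'a fm =
    Eq "'a tm" "'a tm"
  | Mem "'a tm" "'a tm"
  | Neg "'a fm"
  | And "'a fm" "'a fm"
  | BAll nat "'a tm" "'a fm"

primrec fv_tm :: "'a tm \<Rightarrow> nat set" where
  "fv_tm (Const a) = {}"
| "fv_tm (Var x) = {x}"
| "fv_tm (Pair t u) = fv_tm t \<union> fv_tm u"
| "fv_tm (App t u) = fv_tm t \<union> fv_tm u"

primrec fv_fm :: "'a fm \<Rightarrow> nat set" where
  "fv_fm (Eq t u) = fv_tm t \<union> fv_tm u"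
| "fv_fm (Mem t u) = fv_tm t \<union> fv_tm u"
| "fv_fm (Neg \<phi>) = fv_fm \<phi>"
| "fv_fm (And \<phi> \<psi>) = fv_fm \<phi> \<union> fv_fm \<psi>"
| "fv_fm (BAll x t \<phi>) = fv_tm t \<union> (fv_fm \<phi> - {x})"

primrec val :: "(nat \<Rightarrow> 'a) \<Rightarrow> 'a::urelement_universe tm \<Rightarrow> 'a" where
  "val e (Const a) = a"
| "val e (Var x) = e x"
| "val e (Pair t u) = opair (val e t) (val e u)"
| "val e (App t u) = app (val e t) (val e u)"

primrec sat :: "(nat \<Rightarrow> 'a) \<Rightarrow> 'a::urelement_universe fm \<Rightarrow> bool" where
  "sat e (Eq t u) \<longleftrightarrow> val e t = val e u"
| "sat e (Mem t u) \<longleftrightarrow> val e t \<in> elts (val e u)"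
| "sat e (Neg \<phi>) \<longleftrightarrow> \<not> sat e \<phi>"
| "sat e (And \<phi> \<psi>) \<longleftrightarrow> sat e \<phi> \<and> sat e \<psi>"
| "sat e (BAll x t \<phi>) \<longleftrightarrow> (\<forall>a\<in>elts (val e t). sat (e(x := a)) \<phi>)"

text \<open>\<open>set_fm \<phi>\<close> is the set of constants of \<open>\<phi>\<close>.\<close>

definition is_statement_in :: "'a::urelement_universe set \<Rightarrow> 'a fm \<Rightarrow> bool" where
  "is_statement_in S \<phi> \<longleftrightarrow> fv_fm \<phi> = {} \<and> set_fm \<phi> \<subseteq> superstructure S"

definition true_statement :: "'a::urelement_universe fm \<Rightarrow> bool" where
  "true_statement \<phi> \<longleftrightarrow> (\<forall>e. sat e \<phi>)"


section \<open>Enlargements\<close>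

definition internal :: "'a::urelement_universe set \<Rightarrow> ('a \<Rightarrow> 'a) \<Rightarrow> 'a set" where
  "internal S star = (\<Union>A\<in>superstructure S - S. elts (star A))"

definition transfer_principle :: "'a::urelement_universe set \<Rightarrow> ('a \<Rightarrow> 'a) \<Rightarrow> bool" where
  "transfer_principle S star \<longleftrightarrow>
     (\<forall>\<phi>. is_statement_in S \<phi> \<longrightarrow> (true_statement \<phi> \<longleftrightarrow> true_statement (map_fm star \<phi>)))"

text \<open>Since the index set has at most the cardinality of \<open>superstructure S\<close>, it may be taken to be
  a set of elements of the universe.\<close>

definition saturated :: "'a::urelement_universe set \<Rightarrow> ('a \<Rightarrow> 'a) \<Rightarrow> bool" where
  "saturated S star \<longleftrightarrow>
     (\<forall>(I :: 'a set) U.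
        I \<noteq> {} \<longrightarrow> I \<lesssim> superstructure S \<longrightarrow>
        (\<forall>i\<in>I. U i \<in> internal S star \<and> is_set (U i) \<and> elts (U i) \<noteq> {}) \<longrightarrow>
        (\<forall>J\<subseteq>I. finite J \<longrightarrow> J \<noteq> {} \<longrightarrow> (\<Inter>i\<in>J. elts (U i)) \<noteq> {}) \<longrightarrow>
        (\<Inter>i\<in>I. elts (U i)) \<noteq> {})"

text \<open>The values of \<open>star\<close> outside \<open>superstructure S\<close> are irrelevant.\<close>

definition enlargement ::
    "'a::urelement_universe set \<Rightarrow> 'a set \<Rightarrow> ('a \<Rightarrow> 'a) \<Rightarrow> bool" where
  "enlargement S W star \<longleftrightarrow>
     base_set S \<and> base_set W \<and>
     star ` superstructure S \<subseteq> superstructure W \<and>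
     star (mk_set S) = mk_set W \<and>
     (\<forall>s\<in>S. star s = s) \<and>
     transfer_principle S star \<and>
     saturated S star"


section \<open>Categories, functors, adjunctions\<close>

text \<open>A category \<open>\<langle>M, s, t, c\<rangle>\<close> all of whose components are sets of the ambient universe.
  Objects are the identity morphisms.\<close>

record 'a cat =
  Mor :: 'a
  Src :: 'a
  Tgt :: 'a
  Comp :: 'a

definition src :: "'a::urelement_universe cat \<Rightarrow> 'a \<Rightarrow> 'a" where
  "src C f = app (Src C) f"

definition tgt :: "'a::urelement_universe cat \<Rightarrow> 'a \<Rightarrow> 'a" where
  "tgt C f = app (Tgt C) f"

definition composite :: "'a::urelement_universe cat \<Rightarrow> 'a \<Rightarrow> 'a \<Rightarrow> 'a \<Rightarrow> bool" where
  "composite C f g h \<longleftrightarrow> otriple f g h \<in> elts (Comp C)"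

definition compose :: "'a::urelement_universe cat \<Rightarrow> 'a \<Rightarrow> 'a \<Rightarrow> 'a" where
  "compose C f g = (THE h. composite C f g h)"

definition category :: "'a::urelement_universe cat \<Rightarrow> bool" where
  "category C \<longleftrightarrow>
     is_set (Mor C) \<and> is_fun (Src C) (Mor C) (Mor C) \<and> is_fun (Tgt C) (Mor C) (Mor C) \<and>
     is_set (Comp C) \<and>
     elts (Comp C) \<subseteq>
       {otriple f g h | f g h. f \<in> elts (Mor C) \<and> g \<in> elts (Mor C) \<and> h \<in> elts (Mor C)} \<and>
     (\<forall>f\<in>elts (Mor C).
        src C (src C f) = src C f \<and> tgt C (src C f) = src C f \<and>
        src C (tgt C f) = tgt C f \<and> tgt C (tgt C f) = tgt C f) \<and>
     (\<forall>f\<in>elts (Mor C). \<forall>g\<in>elts (Mor C).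
        ((\<exists>h. composite C f g h) \<longleftrightarrow> src C f = tgt C g)) \<and>
     (\<forall>f g h h'. composite C f g h \<longrightarrow> composite C f g h' \<longrightarrow> h = h') \<and>
     (\<forall>f g h. composite C f g h \<longrightarrow> src C h = src C g \<and> tgt C h = tgt C f) \<and>
     (\<forall>f\<in>elts (Mor C). composite C f (src C f) f \<and> composite C (tgt C f) f f) \<and>
     (\<forall>f\<in>elts (Mor C). \<forall>g\<in>elts (Mor C). \<forall>h\<in>elts (Mor C).
        src C f = tgt C g \<longrightarrow> src C g = tgt C h \<longrightarrow>
        compose C (compose C f g) h = compose C f (compose C g h))"

definition Obj :: "'a::urelement_universe cat \<Rightarrow> 'a set" where
  "Obj C = {X \<in> elts (Mor C). src C X = X \<and> tgt C X = X}"

definition Hom :: "'a::urelement_universe cat \<Rightarrow> 'a \<Rightarrow> 'a \<Rightarrow> 'a set" where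
  "Hom C X Y = {f \<in> elts (Mor C). src C f = X \<and> tgt C f = Y}"

definition covariant_functor ::
    "'a::urelement_universe cat \<Rightarrow> 'a cat \<Rightarrow> 'a \<Rightarrow> bool" where
  "covariant_functor C D F \<longleftrightarrow>
     category C \<and> category D \<and> is_fun F (Mor C) (Mor D) \<and>
     (\<forall>f\<in>elts (Mor C). app F (src C f) = src D (app F f) \<and> app F (tgt C f) = tgt D (app F f)) \<and>
     (\<forall>f g h. composite C f g h \<longrightarrow> composite D (app F f) (app F g) (app F h))"

text \<open>\<open>F : C \<rightarrow> D\<close> is left adjoint to \<open>G : D \<rightarrow> C\<close>: there are bijections
  \<open>Hom\<^sub>D(F X, Y) \<cong> Hom\<^sub>C(X, G Y)\<close> natural in \<open>X\<close> and \<open>Y\<close>. The family of bijections is not required to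
  be an element of any superstructure, nor (for enlarged categories) to be internal.\<close>

definition left_adjoint ::
    "'a::urelement_universe cat \<Rightarrow> 'a cat \<Rightarrow> 'a \<Rightarrow> 'a \<Rightarrow> bool" where
  "left_adjoint C D F G \<longleftrightarrow>
     covariant_functor C D F \<and> covariant_functor D C G \<and>
     (\<exists>\<Phi> :: 'a \<Rightarrow> 'a \<Rightarrow> 'a \<Rightarrow> 'a.
        (\<forall>X\<in>Obj C. \<forall>Y\<in>Obj D. bij_betw (\<Phi> X Y) (Hom D (app F X) Y) (Hom C X (app G Y))) \<and>
        (\<forall>X\<in>Obj C. \<forall>X'\<in>Obj C. \<forall>Y\<in>Obj D. \<forall>Y'\<in>Obj D.
           \<forall>f\<in>Hom C X' X. \<forall>g\<in>Hom D Y Y'. \<forall>h\<in>Hom D (app F X) Y.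
             \<Phi> X' Y' (compose D g (compose D h (app F f))) =
             compose C (app G g) (compose C (\<Phi> X Y h) f)))"

definition small_category :: "'a::urelement_universe set \<Rightarrow> 'a cat \<Rightarrow> bool" where
  "small_category S C \<longleftrightarrow> category C \<and> Mor C \<in> superstructure S - S"

definition star_cat :: "('a \<Rightarrow> 'a) \<Rightarrow> 'a cat \<Rightarrow> 'a cat" where
  "star_cat star C =
     \<lparr>Mor = star (Mor C), Src = star (Src C), Tgt = star (Tgt C), Comp = star (Comp C)\<rparr>"

end

theory Submission
  imports Defs
begin

text \<open>
  Everything in sight is expressible by bounded formulas, so the result is an instance of transfer.

  Being a category and being a functor are bounded conditions on the sets \<open>M, s, t, c, F\<close>: the
  lemmas \<open>sat_category_fm\<close> and \<open>sat_functor_fm\<close> exhibit the formulas and show that, for arbitrary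
  sets of the universe, their truth is equivalent to the notion itself. An adjunction involves in
  addition a family of bijections, which is not part of the data. It is traded for one more
  constant: since the categories are small, the map \<open>\<langle>X, Y, h\<rangle> \<mapsto> \<Phi> X Y h\<close> on the morphisms
  \<open>h : F X \<rightarrow> Y\<close> has a graph \<open>P\<close> that is an element of the superstructure
  (\<open>transpose_graph_exists\<close>), and ``application of \<open>P\<close> is a natural family of bijections'' is again a
  bounded condition (\<open>sat_adjunction_fm\<close>).

  Applying \<open>*\<close> to these formulas only replaces their constants, so transfer yields the same
  conditions for \<open>*C\<close>, \<open>*D\<close>, \<open>*F\<close>, \<open>*G\<close> and \<open>*P\<close>; the adjunction of the enlarged functors is the
  internal one given by \<open>*P\<close>. That the objects
  involved are sets rather than urelements is treated separately: outside its base set a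
  superstructure consists of sets, and \<open>x \<notin> S\<close> transfers to \<open>*x \<notin> W\<close> (\<open>star_is_set\<close>).
\<close>

section \<open>Sets and ordered pairs\<close>

lemma mk_set_eqI: "is_set y \<Longrightarrow> elts y = A \<Longrightarrow> mk_set A = y"
  unfolding mk_set_def by (rule the_equality) (auto intro: extensionality)

lemma mk_set_pair: "is_set (mk_set {a, b})" "elts (mk_set {a, b}) = {a, b}"
proof -
  obtain y where "is_set y" "elts y = {a, b}" using pairing by blast
  then show "is_set (mk_set {a, b})" "elts (mk_set {a, b}) = {a, b}"
    using mk_set_eqI by blast+
qed

lemma mk_set_singleton: "is_set (mk_set {a})" "elts (mk_set {a}) = {a}"
  using mk_set_pair[of a a] by simp_all

lemma opair_inject [simp]: "opair a b = opair c d \<longleftrightarrow> a = c \<and> b = d"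
proof
  assume "opair a b = opair c d"
  then have "elts (mk_set {mk_set {a}, mk_set {a, b}}) = elts (mk_set {mk_set {c}, mk_set {c, d}})"
    by (simp add: opair_def)
  then have "{mk_set {a}, mk_set {a, b}} = {mk_set {c}, mk_set {c, d}}"
    by (simp only: mk_set_pair)
  then have "elts ` {mk_set {a}, mk_set {a, b}} = elts ` {mk_set {c}, mk_set {c, d}}"
    by (rule arg_cong)
  then have "{{a}, {a, b}} = {{c}, {c, d}}"
    by (simp add: mk_set_pair mk_set_singleton)
  then show "a = c \<and> b = d" by (auto simp: doubleton_eq_iff)
qed simp

lemma otriple_inject: "otriple a b c = otriple a' b' c' \<longleftrightarrow> a = a' \<and> b = b' \<and> c = c'"
  by (simp add: otriple_def)

lemma app_eqI: "(\<And>z. opair x z \<in> elts f \<longleftrightarrow> z = y) \<Longrightarrow> app f x = y"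
  by (simp add: app_def)

lemma is_fun_app: "is_fun f A B \<Longrightarrow> x \<in> elts A \<Longrightarrow> app f x \<in> elts B"
proof -
  assume f: "is_fun f A B" and x: "x \<in> elts A"
  then obtain y where y: "opair x y \<in> elts f" "\<And>z. opair x z \<in> elts f \<Longrightarrow> z = y"
    unfolding is_fun_def by blast
  then have "app f x = y" by (intro app_eqI) blast
  moreover have "y \<in> elts B" using f y(1) unfolding is_fun_def by fastforce
  ultimately show ?thesis by simp
qed


section \<open>Superstructures\<close>

lemma level_mono: "m \<le> n \<Longrightarrow> level S m \<subseteq> level S n"
  by (induction n rule: dec_induct) auto

lemma set_in_levelI: "is_set x \<Longrightarrow> elts x \<subseteq> level S n \<Longrightarrow> x \<in> level S (Suc n)"
  by simp

lemma opair_in_level: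
  assumes "a \<in> level S n" "b \<in> level S n"
  shows "opair a b \<in> level S (Suc (Suc n))"
  unfolding opair_def
  by (intro set_in_levelI) (use assms in \<open>auto simp: mk_set_pair mk_set_singleton\<close>)

lemma otriple_in_level:
  assumes "a \<in> level S n" "b \<in> level S n" "c \<in> level S n"
  shows "otriple a b c \<in> level S (n + 4)"
proof -
  have "c \<in> level S (Suc (Suc n))" using assms(3) by simp
  then have "opair (opair a b) c \<in> level S (Suc (Suc (Suc (Suc n))))"
    using assms by (intro opair_in_level)
  then show ?thesis by (simp only: otriple_def add_Suc_right add_0_right numeral_eq_Suc pred_numeral_simps BitM.simps)
qed

text \<open>The levels are extensions of sets of the universe. By separation, every collection of
  elements of bounded level is then a set as well, and so an element of the superstructure.\<close>

lemma level_is_extension: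
  assumes "base_set S"
  shows "\<exists>y. is_set y \<and> elts y = level S n"
proof (induction n)
  case 0
  then show ?case using assms by (simp add: base_set_def)
next
  case (Suc n)
  then obtain y where y: "is_set y" "elts y = level S n" by blast
  obtain p where p: "is_set p" "elts p = {z. is_set z \<and> elts z \<subseteq> elts y}"
    using power_set by blast
  obtain u where u: "elts u = {y, p}" using pairing by blast
  obtain v where "is_set v" "elts v = (\<Union>z\<in>elts u. elts z)" using union by blast
  then show ?case using u y p by (intro exI[of _ v]) simp
qed

lemma bounded_set_exists:
  assumes "base_set S" "A \<subseteq> level S n"
  obtains y where "is_set y" "elts y = A"
  using assms level_is_extension separation by metis

lemma set_not_base: "base_set S \<Longrightarrow> is_set x \<Longrightarrow> x \<notin> S"
  by (auto simp: base_set_def)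

lemma bounded_set_in_superstructure:
  assumes "base_set S" "is_set x" "elts x \<subseteq> level S n"
  shows "x \<in> superstructure S - S"
  using set_in_levelI[OF assms(2,3)] set_not_base[OF assms(1,2)]
  by (auto simp: superstructure_def simp del: level.simps)

lemma superstructure_setE:
  assumes "x \<in> superstructure S - S"
  obtains n where "is_set x" "elts x \<subseteq> level S n"
proof -
  have "x \<in> level S k \<Longrightarrow> x \<notin> S \<Longrightarrow> \<exists>n. is_set x \<and> elts x \<subseteq> level S n" for k
    by (induction k) auto
  then show ?thesis using assms that by (auto simp: superstructure_def)
qed

lemma is_fun_in_superstructure:
  assumes "base_set S" "is_fun f A B" "A \<in> superstructure S - S" "B \<in> superstructure S - S"
  shows "f \<in> superstructure S - S"
proof -
  obtain m n where "elts A \<subseteq> level S m" "elts B \<subseteq> level S n"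
    using assms(3,4) superstructure_setE by metis
  then have "elts A \<subseteq> level S (max m n)" "elts B \<subseteq> level S (max m n)"
    using level_mono max.cobounded1 max.cobounded2 by blast+
  then have "{opair x y | x y. x \<in> elts A \<and> y \<in> elts B} \<subseteq> level S (Suc (Suc (max m n)))"
    by (auto simp del: level.simps intro!: opair_in_level)
  then have "elts f \<subseteq> level S (Suc (Suc (max m n)))"
    using assms(2) unfolding is_fun_def by (elim conjE) (rule order_trans)
  then show ?thesis
    using assms(1,2) bounded_set_in_superstructure is_fun_def by blast
qed


section \<open>Transfer\<close>

text \<open>Implication and bounded existential quantification, expressed by the primitive connectives.\<close>

definition Imp :: "'a fm \<Rightarrow> 'a fm \<Rightarrow> 'a fm" where
  "Imp \<phi> \<psi> = Neg (And \<phi> (Neg \<psi>))"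

definition BEx :: "nat \<Rightarrow> 'a tm \<Rightarrow> 'a fm \<Rightarrow> 'a fm" where
  "BEx x t \<phi> = Neg (BAll x t (Neg \<phi>))"

lemma Imp_simps [simp]:
  "sat e (Imp \<phi> \<psi>) \<longleftrightarrow> (sat e \<phi> \<longrightarrow> sat e \<psi>)"
  "fv_fm (Imp \<phi> \<psi>) = fv_fm \<phi> \<union> fv_fm \<psi>"
  "set_fm (Imp \<phi> \<psi>) = set_fm \<phi> \<union> set_fm \<psi>"
  "map_fm k (Imp \<phi> \<psi>) = Imp (map_fm k \<phi>) (map_fm k \<psi>)"
  by (simp_all add: Imp_def)

lemma BEx_simps [simp]:
  "sat e (BEx x t \<phi>) \<longleftrightarrow> (\<exists>a\<in>elts (val e t). sat (e(x := a)) \<phi>)"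
  "fv_fm (BEx x t \<phi>) = fv_tm t \<union> (fv_fm \<phi> - {x})"
  "set_fm (BEx x t \<phi>) = set_tm t \<union> set_fm \<phi>"
  "map_fm k (BEx x t \<phi>) = BEx x (map_tm k t) (map_fm k \<phi>)"
  by (simp_all add: BEx_def)

lemma val_cong: "(\<And>x. x \<in> fv_tm t \<Longrightarrow> e x = e' x) \<Longrightarrow> val e t = val e' t"
  by (induction t) auto

lemma sat_cong: "(\<And>x. x \<in> fv_fm \<phi> \<Longrightarrow> e x = e' x) \<Longrightarrow> sat e \<phi> \<longleftrightarrow> sat e' \<phi>"
proof (induction \<phi> arbitrary: e e')
  case (Eq t u)
  then show ?case using val_cong[of t e e'] val_cong[of u e e'] by simp
next
  case (Mem t u)
  then show ?case using val_cong[of t e e'] val_cong[of u e e'] by simp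
next
  case (Neg \<phi>)
  have "sat e \<phi> \<longleftrightarrow> sat e' \<phi>" by (rule Neg.IH) (use Neg.prems in simp)
  then show ?case by simp
next
  case (And \<phi> \<psi>)
  have "sat e \<phi> \<longleftrightarrow> sat e' \<phi>" by (rule And.IH(1)) (use And.prems in simp)
  moreover have "sat e \<psi> \<longleftrightarrow> sat e' \<psi>" by (rule And.IH(2)) (use And.prems in simp)
  ultimately show ?case by simp
next
  case (BAll x t \<phi>)
  have "val e t = val e' t" using BAll.prems by (intro val_cong) simp
  moreover have "sat (e(x := a)) \<phi> \<longleftrightarrow> sat (e'(x := a)) \<phi>" for a
    by (rule BAll.IH) (use BAll.prems in simp)
  ultimately show ?case by simp
qed

lemma fv_fm_map_fm: "fv_fm (map_fm k \<phi>) = fv_fm \<phi>"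
proof -
  have "fv_tm (map_tm k t) = fv_tm t" for t by (induction t) auto
  then show ?thesis by (induction \<phi>) auto
qed

lemma true_statement_iff: "fv_fm \<phi> = {} \<Longrightarrow> true_statement \<phi> \<longleftrightarrow> sat e \<phi>"
  unfolding true_statement_def using sat_cong[of \<phi>] by blast

text \<open>The valuation is irrelevant for sentences, so truth may be evaluated at a single one.\<close>

lemma transfer:
  assumes "enlargement S W star" "fv_fm \<phi> = {}" "set_fm \<phi> \<subseteq> superstructure S"
  shows "sat e (map_fm star \<phi>) \<longleftrightarrow> sat e \<phi>"
proof -
  have "true_statement (map_fm star \<phi>) \<longleftrightarrow> true_statement \<phi>"
    using assms by (simp add: enlargement_def transfer_principle_def is_statement_in_def)
  then show ?thesis
    using assms(2) true_statement_iff[of \<phi> e] true_statement_iff[of "map_fm star \<phi>" e]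
    by (simp add: fv_fm_map_fm)
qed

text \<open>A formula cannot tell the empty set from an urelement directly, but it can say that \<open>x\<close> does
  not belong to the base set.\<close>

lemma star_is_set:
  assumes "enlargement S W star" "x \<in> superstructure S - S"
  shows "is_set (star x)"
proof -
  have S: "base_set S" and W: "base_set W" using assms(1) by (auto simp: enlargement_def)
  \<comment> \<open>\<open>mk_set\<close> yields a genuine set here because a base set is the extension of one.\<close>
  have mk: "is_set (mk_set A) \<and> elts (mk_set A) = A" if "base_set A" for A :: "'a set"
    using that mk_set_eqI unfolding base_set_def by metis
  have "mk_set S \<in> superstructure S"
    using bounded_set_in_superstructure[OF S, of "mk_set S" 0] mk[OF S] by simp
  moreover have "mk_set W = star (mk_set S)" using assms(1) by (simp add: enlargement_def)
  ultimately have "star x \<notin> W"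
    using transfer[OF assms(1), of "Mem (Const x) (Const (mk_set S))"] assms(2) mk[OF S] mk[OF W]
    by simp
  moreover have "star x \<in> superstructure W"
    using assms by (auto simp: enlargement_def)
  ultimately show ?thesis using superstructure_setE by blast
qed


section \<open>Categories and functors as formulas\<close>

text \<open>\<open>f\<close> is a function from \<open>A\<close> to \<open>B\<close>, apart from the requirement that \<open>f\<close> be a set. Uniqueness
  of values is only demanded within \<open>B\<close>, which suffices because all pairs in \<open>f\<close> have their second
  component in \<open>B\<close>.\<close>

definition fun_fm :: "'a \<Rightarrow> 'a \<Rightarrow> 'a \<Rightarrow> 'a fm" where
  "fun_fm f A B =
     And (BAll 0 (Const f) (BEx 1 (Const A) (BEx 2 (Const B) (Eq (Var 0) (tm.Pair (Var 1) (Var 2))))))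
         (BAll 0 (Const A) (BEx 1 (Const B) (And (Mem (tm.Pair (Var 0) (Var 1)) (Const f))
            (BAll 2 (Const B) (Imp (Mem (tm.Pair (Var 0) (Var 2)) (Const f)) (Eq (Var 2) (Var 1)))))))"

lemma sat_fun_fm: "is_set f \<Longrightarrow> sat e (fun_fm f A B) \<longleftrightarrow> is_fun f A B"
proof -
  assume f: "is_set f"
  have "sat e (fun_fm f A B) \<longleftrightarrow>
      (\<forall>p\<in>elts f. \<exists>x\<in>elts A. \<exists>y\<in>elts B. p = opair x y) \<and>
      (\<forall>x\<in>elts A. \<exists>y\<in>elts B. opair x y \<in> elts f \<and> (\<forall>z\<in>elts B. opair x z \<in> elts f \<longrightarrow> z = y))"
    by (simp add: fun_fm_def)
  also have "\<dots> \<longleftrightarrow> is_fun f A B" (is "?L \<longleftrightarrow> _")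
  proof
    assume L: ?L
    have "y \<in> elts B" if "opair x y \<in> elts f" for x y using L that by force
    then show "is_fun f A B" using L f unfolding is_fun_def by blast
  next
    assume R: "is_fun f A B"
    then have *: "\<forall>p\<in>elts f. \<exists>x\<in>elts A. \<exists>y\<in>elts B. p = opair x y"
      unfolding is_fun_def by blast
    then have "y \<in> elts B" if "opair x y \<in> elts f" for x y using that by force
    then show ?L using R * unfolding is_fun_def by blast
  qed
  finally show ?thesis .
qed

text \<open>Terms and formulas for the structure of a category. The composite of two morphisms is the
  relation \<open>c\<close> applied to a pair: see \<open>compose_eq_app\<close> below.\<close>

abbreviation src_tm :: "'a cat \<Rightarrow> 'a tm \<Rightarrow> 'a tm" where
  "src_tm C \<equiv> App (Const (Src C))"

abbreviation tgt_tm :: "'a cat \<Rightarrow> 'a tm \<Rightarrow> 'a tm" where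
  "tgt_tm C \<equiv> App (Const (Tgt C))"

abbreviation compose_tm :: "'a cat \<Rightarrow> 'a tm \<Rightarrow> 'a tm \<Rightarrow> 'a tm" where
  "compose_tm C t u \<equiv> App (Const (Comp C)) (tm.Pair t u)"

abbreviation composite_fm :: "'a cat \<Rightarrow> 'a tm \<Rightarrow> 'a tm \<Rightarrow> 'a tm \<Rightarrow> 'a fm" where
  "composite_fm C t u v \<equiv> Mem (tm.Pair (tm.Pair t u) v) (Const (Comp C))"

abbreviation BAll_mor :: "nat \<Rightarrow> 'a cat \<Rightarrow> 'a fm \<Rightarrow> 'a fm" where
  "BAll_mor x C \<equiv> BAll x (Const (Mor C))"

abbreviation BEx_mor :: "nat \<Rightarrow> 'a cat \<Rightarrow> 'a fm \<Rightarrow> 'a fm" where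
  "BEx_mor x C \<equiv> BEx x (Const (Mor C))"

text \<open>The axioms of a category, with all quantifiers bounded by the set of morphisms or by the
  composition relation.\<close>

definition category_fm :: "'a cat \<Rightarrow> 'a fm" where
  "category_fm C =
     And (fun_fm (Src C) (Mor C) (Mor C))
    (And (fun_fm (Tgt C) (Mor C) (Mor C))
    (And (BAll 0 (Const (Comp C)) (BEx_mor 1 C (BEx_mor 2 C (BEx_mor 3 C
            (Eq (Var 0) (tm.Pair (tm.Pair (Var 1) (Var 2)) (Var 3)))))))
    (And (BAll_mor 0 C
            (And (Eq (src_tm C (src_tm C (Var 0))) (src_tm C (Var 0)))
            (And (Eq (tgt_tm C (src_tm C (Var 0))) (src_tm C (Var 0)))
            (And (Eq (src_tm C (tgt_tm C (Var 0))) (tgt_tm C (Var 0)))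
                 (Eq (tgt_tm C (tgt_tm C (Var 0))) (tgt_tm C (Var 0)))))))
    (And (BAll_mor 0 C (BAll_mor 1 C
            (And (Imp (BEx_mor 2 C (composite_fm C (Var 0) (Var 1) (Var 2)))
                      (Eq (src_tm C (Var 0)) (tgt_tm C (Var 1))))
                 (Imp (Eq (src_tm C (Var 0)) (tgt_tm C (Var 1)))
                      (BEx_mor 2 C (composite_fm C (Var 0) (Var 1) (Var 2)))))))
    (And (BAll_mor 0 C (BAll_mor 1 C (BAll_mor 2 C (BAll_mor 3 C
            (Imp (composite_fm C (Var 0) (Var 1) (Var 2))
            (Imp (composite_fm C (Var 0) (Var 1) (Var 3)) (Eq (Var 2) (Var 3))))))))
    (And (BAll_mor 0 C (BAll_mor 1 C (BAll_mor 2 C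
            (Imp (composite_fm C (Var 0) (Var 1) (Var 2))
              (And (Eq (src_tm C (Var 2)) (src_tm C (Var 1)))
                   (Eq (tgt_tm C (Var 2)) (tgt_tm C (Var 0))))))))
    (And (BAll_mor 0 C
            (And (composite_fm C (Var 0) (src_tm C (Var 0)) (Var 0))
                 (composite_fm C (tgt_tm C (Var 0)) (Var 0) (Var 0))))
         (BAll_mor 0 C (BAll_mor 1 C (BAll_mor 2 C
            (Imp (Eq (src_tm C (Var 0)) (tgt_tm C (Var 1)))
            (Imp (Eq (src_tm C (Var 1)) (tgt_tm C (Var 2)))
                 (Eq (compose_tm C (compose_tm C (Var 0) (Var 1)) (Var 2))
                     (compose_tm C (Var 0) (compose_tm C (Var 1) (Var 2))))))))))))))))"

text \<open>Since a triple is a pair whose first component is a pair, the composition relation is itself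
  the graph of a partial function on pairs, so that composites can be written as terms.\<close>

lemma compose_eq_app:
  assumes "\<exists>!h. composite C f g h"
  shows "compose C f g = app (Comp C) (opair f g)"
  using assms by (simp add: compose_def composite_def app_def otriple_def)

lemma composite_closed:
  assumes "elts (Comp C) \<subseteq>
       {otriple f g h | f g h. f \<in> elts (Mor C) \<and> g \<in> elts (Mor C) \<and> h \<in> elts (Mor C)}"
    and "composite C f g h"
  shows "f \<in> elts (Mor C)" "g \<in> elts (Mor C)" "h \<in> elts (Mor C)"
  using assms unfolding composite_def by (auto simp: otriple_inject)

text \<open>The axioms of a category other than associativity. They make composition a partial function,
  which is needed before associativity can be rephrased as an equation between terms.\<close>

definition precategory :: "'a::urelement_universe cat \<Rightarrow> bool" where
  "precategory C \<longleftrightarrow>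
     is_set (Mor C) \<and> is_fun (Src C) (Mor C) (Mor C) \<and> is_fun (Tgt C) (Mor C) (Mor C) \<and>
     is_set (Comp C) \<and>
     elts (Comp C) \<subseteq>
       {otriple f g h | f g h. f \<in> elts (Mor C) \<and> g \<in> elts (Mor C) \<and> h \<in> elts (Mor C)} \<and>
     (\<forall>f\<in>elts (Mor C).
        src C (src C f) = src C f \<and> tgt C (src C f) = src C f \<and>
        src C (tgt C f) = tgt C f \<and> tgt C (tgt C f) = tgt C f) \<and>
     (\<forall>f\<in>elts (Mor C). \<forall>g\<in>elts (Mor C).
        ((\<exists>h. composite C f g h) \<longleftrightarrow> src C f = tgt C g)) \<and>
     (\<forall>f g h h'. composite C f g h \<longrightarrow> composite C f g h' \<longrightarrow> h = h') \<and>
     (\<forall>f g h. composite C f g h \<longrightarrow> src C h = src C g \<and> tgt C h = tgt C f) \<and>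
     (\<forall>f\<in>elts (Mor C). composite C f (src C f) f \<and> composite C (tgt C f) f f)"

lemma category_iff_precategory:
  "category C \<longleftrightarrow> precategory C \<and>
     (\<forall>f\<in>elts (Mor C). \<forall>g\<in>elts (Mor C). \<forall>h\<in>elts (Mor C).
        src C f = tgt C g \<longrightarrow> src C g = tgt C h \<longrightarrow>
        compose C (compose C f g) h = compose C f (compose C g h))"
  unfolding category_def precategory_def by (simp only: conj_assoc)

lemma category_components:
  assumes "category C"
  shows "is_set (Mor C)" "is_fun (Src C) (Mor C) (Mor C)" "is_fun (Tgt C) (Mor C) (Mor C)"
    "is_set (Src C)" "is_set (Tgt C)" "is_set (Comp C)"
    "elts (Comp C) \<subseteq>
       {otriple f g h | f g h. f \<in> elts (Mor C) \<and> g \<in> elts (Mor C) \<and> h \<in> elts (Mor C)}"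
proof -
  have C: "is_set (Mor C) \<and> is_fun (Src C) (Mor C) (Mor C) \<and> is_fun (Tgt C) (Mor C) (Mor C) \<and>
     is_set (Comp C) \<and> elts (Comp C) \<subseteq>
       {otriple f g h | f g h. f \<in> elts (Mor C) \<and> g \<in> elts (Mor C) \<and> h \<in> elts (Mor C)}"
    using assms unfolding category_def by (elim conjE) (intro conjI)
  from C show "is_set (Mor C)" by (elim conjE)
  from C show S: "is_fun (Src C) (Mor C) (Mor C)" by (elim conjE)
  from C show T: "is_fun (Tgt C) (Mor C) (Mor C)" by (elim conjE)
  from S T show "is_set (Src C)" "is_set (Tgt C)" by (simp_all add: is_fun_def)
  from C show "is_set (Comp C)" by (elim conjE)
  from C show "elts (Comp C) \<subseteq>
       {otriple f g h | f g h. f \<in> elts (Mor C) \<and> g \<in> elts (Mor C) \<and> h \<in> elts (Mor C)}"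
    by (elim conjE)
qed

lemma precategory_compose:
  assumes C: "precategory C" and f: "f \<in> elts (Mor C)" and g: "g \<in> elts (Mor C)"
    and "src C f = tgt C g"
  shows "compose C f g = app (Comp C) (opair f g)" "compose C f g \<in> elts (Mor C)"
    "src C (compose C f g) = src C g" "tgt C (compose C f g) = tgt C f"
proof -
  have ex: "\<exists>!h. composite C f g h"
    using assms unfolding precategory_def by blast
  then have comp: "composite C f g (compose C f g)"
    unfolding compose_def by (rule theI')
  show "compose C f g = app (Comp C) (opair f g)" by (rule compose_eq_app[OF ex])
  show "compose C f g \<in> elts (Mor C)"
    by (rule composite_closed[OF _ comp]) (use C in \<open>simp add: precategory_def\<close>)
  show "src C (compose C f g) = src C g" "tgt C (compose C f g) = tgt C f"
    using C comp unfolding precategory_def by blast+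
qed

text \<open>Bounding the quantifiers over composites loses nothing, as the composition relation consists
  of triples of morphisms.\<close>

lemma sat_category_fm:
  assumes "is_set (Mor C)" "is_set (Src C)" "is_set (Tgt C)" "is_set (Comp C)"
  shows "sat e (category_fm C) \<longleftrightarrow> category C"
proof -
  let ?M = "elts (Mor C)"
  let ?bounded = "is_fun (Src C) (Mor C) (Mor C) \<and> is_fun (Tgt C) (Mor C) (Mor C) \<and>
     (\<forall>p\<in>elts (Comp C). \<exists>f\<in>?M. \<exists>g\<in>?M. \<exists>h\<in>?M. p = otriple f g h) \<and>
     (\<forall>f\<in>?M. src C (src C f) = src C f \<and> tgt C (src C f) = src C f \<and>
        src C (tgt C f) = tgt C f \<and> tgt C (tgt C f) = tgt C f) \<and>
     (\<forall>f\<in>?M. \<forall>g\<in>?M. ((\<exists>h\<in>?M. composite C f g h) \<longrightarrow> src C f = tgt C g) \<and>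
        (src C f = tgt C g \<longrightarrow> (\<exists>h\<in>?M. composite C f g h))) \<and>
     (\<forall>f\<in>?M. \<forall>g\<in>?M. \<forall>h\<in>?M. \<forall>h'\<in>?M.
        composite C f g h \<longrightarrow> composite C f g h' \<longrightarrow> h = h') \<and>
     (\<forall>f\<in>?M. \<forall>g\<in>?M. \<forall>h\<in>?M. composite C f g h \<longrightarrow> src C h = src C g \<and> tgt C h = tgt C f) \<and>
     (\<forall>f\<in>?M. composite C f (src C f) f \<and> composite C (tgt C f) f f)"
  let ?assoc = "\<forall>f\<in>?M. \<forall>g\<in>?M. \<forall>h\<in>?M. src C f = tgt C g \<longrightarrow> src C g = tgt C h \<longrightarrow>
        app (Comp C) (opair (app (Comp C) (opair f g)) h)
        = app (Comp C) (opair f (app (Comp C) (opair g h)))"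
  have sat: "sat e (category_fm C) \<longleftrightarrow> ?bounded \<and> ?assoc"
    unfolding category_fm_def using assms
    by (simp add: sat_fun_fm src_def tgt_def composite_def otriple_def)
  have pre: "?bounded \<longleftrightarrow> precategory C"
  proof
    assume B: ?bounded
    then have "\<forall>p\<in>elts (Comp C). \<exists>f\<in>?M. \<exists>g\<in>?M. \<exists>h\<in>?M. p = otriple f g h" by (elim conjE)
    then have sub: "elts (Comp C) \<subseteq> {otriple f g h | f g h. f \<in> ?M \<and> g \<in> ?M \<and> h \<in> ?M}" by blast
    note M = composite_closed[OF sub]
    have "\<forall>f\<in>?M. \<forall>g\<in>?M. (\<exists>h. composite C f g h) \<longleftrightarrow> src C f = tgt C g"
      using B M(3) by (elim conjE) meson
    moreover have "\<forall>f g h h'. composite C f g h \<longrightarrow> composite C f g h' \<longrightarrow> h = h'"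
      using B M by (elim conjE) meson
    moreover have "\<forall>f g h. composite C f g h \<longrightarrow> src C h = src C g \<and> tgt C h = tgt C f"
      using B M by (elim conjE) meson
    ultimately show "precategory C"
      unfolding precategory_def using B assms sub by (elim conjE) (intro conjI)
  next
    assume P: "precategory C"
    then have sub: "elts (Comp C) \<subseteq> {otriple f g h | f g h. f \<in> ?M \<and> g \<in> ?M \<and> h \<in> ?M}"
      by (simp add: precategory_def)
    then have "\<forall>p\<in>elts (Comp C). \<exists>f\<in>?M. \<exists>g\<in>?M. \<exists>h\<in>?M. p = otriple f g h" by blast
    moreover have "\<forall>f\<in>?M. \<forall>g\<in>?M. ((\<exists>h\<in>?M. composite C f g h) \<longrightarrow> src C f = tgt C g) \<and>
        (src C f = tgt C g \<longrightarrow> (\<exists>h\<in>?M. composite C f g h))"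
      using P composite_closed(3)[OF sub] unfolding precategory_def by (elim conjE) meson
    moreover have "\<forall>f\<in>?M. \<forall>g\<in>?M. \<forall>h\<in>?M. \<forall>h'\<in>?M.
        composite C f g h \<longrightarrow> composite C f g h' \<longrightarrow> h = h'"
      using P unfolding precategory_def by (elim conjE) meson
    moreover have "\<forall>f\<in>?M. \<forall>g\<in>?M. \<forall>h\<in>?M.
        composite C f g h \<longrightarrow> src C h = src C g \<and> tgt C h = tgt C f"
      using P unfolding precategory_def by (elim conjE) meson
    ultimately show ?bounded
      using P unfolding precategory_def by (elim conjE) (intro conjI)
  qed
  have "?assoc \<longleftrightarrow> (\<forall>f\<in>?M. \<forall>g\<in>?M. \<forall>h\<in>?M. src C f = tgt C g \<longrightarrow> src C g = tgt C h \<longrightarrow>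
      compose C (compose C f g) h = compose C f (compose C g h))" if P: "precategory C"
  proof (intro ball_cong refl imp_cong)
    fix f g h
    assume "f \<in> ?M" "g \<in> ?M" "h \<in> ?M" "src C f = tgt C g" "src C g = tgt C h"
    then show "app (Comp C) (opair (app (Comp C) (opair f g)) h)
        = app (Comp C) (opair f (app (Comp C) (opair g h))) \<longleftrightarrow>
      compose C (compose C f g) h = compose C f (compose C g h)"
      using precategory_compose[OF P] by metis
  qed
  then show ?thesis unfolding sat pre category_iff_precategory by (rule conj_cong[OF refl])
qed

lemma covariant_functorD:
  assumes "covariant_functor C D F"
  shows "category C" "category D" "is_fun F (Mor C) (Mor D)"
proof -
  from assms show "category C" unfolding covariant_functor_def by (elim conjE)
  from assms show "category D" unfolding covariant_functor_def by (elim conjE)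
  from assms show "is_fun F (Mor C) (Mor D)" unfolding covariant_functor_def by (elim conjE)
qed

text \<open>\<open>F\<close> is a functor from \<open>C\<close> to \<open>D\<close>, given that \<open>C\<close> and \<open>D\<close> are categories and \<open>F\<close> is a set.\<close>

definition functor_fm :: "'a cat \<Rightarrow> 'a cat \<Rightarrow> 'a \<Rightarrow> 'a fm" where
  "functor_fm C D F =
     And (fun_fm F (Mor C) (Mor D))
    (And (BAll_mor 0 C
            (And (Eq (App (Const F) (src_tm C (Var 0))) (src_tm D (App (Const F) (Var 0))))
                 (Eq (App (Const F) (tgt_tm C (Var 0))) (tgt_tm D (App (Const F) (Var 0))))))
         (BAll_mor 0 C (BAll_mor 1 C (BAll_mor 2 C
            (Imp (composite_fm C (Var 0) (Var 1) (Var 2))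
                 (composite_fm D (App (Const F) (Var 0)) (App (Const F) (Var 1))
                    (App (Const F) (Var 2))))))))"

lemma sat_functor_fm:
  assumes "category C" "category D" "is_set F"
  shows "sat e (functor_fm C D F) \<longleftrightarrow> covariant_functor C D F"
proof -
  have sub: "elts (Comp C) \<subseteq>
      {otriple f g h | f g h. f \<in> elts (Mor C) \<and> g \<in> elts (Mor C) \<and> h \<in> elts (Mor C)}"
    using category_components(7)[OF assms(1)] .
  note M = composite_closed[OF sub]
  have sat: "sat e (functor_fm C D F) \<longleftrightarrow> is_fun F (Mor C) (Mor D) \<and>
     (\<forall>f\<in>elts (Mor C). app F (src C f) = src D (app F f) \<and> app F (tgt C f) = tgt D (app F f)) \<and>
     (\<forall>f\<in>elts (Mor C). \<forall>g\<in>elts (Mor C). \<forall>h\<in>elts (Mor C).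
        composite C f g h \<longrightarrow> composite D (app F f) (app F g) (app F h))"
    unfolding functor_fm_def using assms(3)
    by (simp add: sat_fun_fm src_def tgt_def composite_def otriple_def)
  have "(\<forall>f\<in>elts (Mor C). \<forall>g\<in>elts (Mor C). \<forall>h\<in>elts (Mor C).
        composite C f g h \<longrightarrow> composite D (app F f) (app F g) (app F h)) \<longleftrightarrow>
     (\<forall>f g h. composite C f g h \<longrightarrow> composite D (app F f) (app F g) (app F h))"
    using M by meson
  then show ?thesis
    unfolding sat covariant_functor_def using assms(1,2) by (simp only: simp_thms)
qed


section \<open>Adjunctions as formulas\<close>

text \<open>\<open>\<Phi> X Y : Hom\<^sub>D(F X, Y) \<rightarrow> Hom\<^sub>C(X, G Y)\<close> is a bijection, natural in \<open>X\<close> and \<open>Y\<close>.\<close>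

definition adjunction_via ::
    "'a::urelement_universe cat \<Rightarrow> 'a cat \<Rightarrow> 'a \<Rightarrow> 'a \<Rightarrow> ('a \<Rightarrow> 'a \<Rightarrow> 'a \<Rightarrow> 'a) \<Rightarrow> bool" where
  "adjunction_via C D F G \<Phi> \<longleftrightarrow>
     (\<forall>X\<in>Obj C. \<forall>Y\<in>Obj D. bij_betw (\<Phi> X Y) (Hom D (app F X) Y) (Hom C X (app G Y))) \<and>
     (\<forall>X\<in>Obj C. \<forall>X'\<in>Obj C. \<forall>Y\<in>Obj D. \<forall>Y'\<in>Obj D.
        \<forall>f\<in>Hom C X' X. \<forall>g\<in>Hom D Y Y'. \<forall>h\<in>Hom D (app F X) Y.
          \<Phi> X' Y' (compose D g (compose D h (app F f))) =
          compose C (app G g) (compose C (\<Phi> X Y h) f))"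

lemma left_adjoint_iff:
  "left_adjoint C D F G \<longleftrightarrow>
     covariant_functor C D F \<and> covariant_functor D C G \<and> (\<exists>\<Phi>. adjunction_via C D F G \<Phi>)"
  unfolding left_adjoint_def adjunction_via_def ..

lemma category_compose:
  assumes "category C" "f \<in> Hom C Y Z" "g \<in> Hom C X Y"
  shows "compose C f g = app (Comp C) (opair f g)" "compose C f g \<in> Hom C X Z"
  using precategory_compose[of C f g] assms
  by (auto simp: category_iff_precategory Hom_def)

lemma category_objs:
  assumes "category C" "f \<in> Hom C X Y"
  shows "X \<in> Obj C" "Y \<in> Obj C"
proof -
  have f: "f \<in> elts (Mor C)" "X = src C f" "Y = tgt C f" using assms(2) by (auto simp: Hom_def)
  have "src C f \<in> elts (Mor C)" "tgt C f \<in> elts (Mor C)"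
    using assms(1) f(1) is_fun_app unfolding category_def src_def tgt_def by blast+
  then show "X \<in> Obj C" "Y \<in> Obj C"
    using assms(1) f unfolding category_def Obj_def by auto
qed

lemma functor_Hom:
  assumes "covariant_functor C D F" "f \<in> Hom C X Y"
  shows "app F f \<in> Hom D (app F X) (app F Y)"
proof -
  have f: "f \<in> elts (Mor C)" "X = src C f" "Y = tgt C f" using assms(2) by (auto simp: Hom_def)
  then have "app F f \<in> elts (Mor D)"
    using assms(1) is_fun_app unfolding covariant_functor_def by blast
  then show ?thesis using assms(1) f by (simp add: covariant_functor_def Hom_def)
qed

text \<open>A reformulation close to a bounded formula: naturality quantifies over morphisms only, as they
  determine their objects, and composites are written as applications of the composition relations.
  The latter is legitimate because the bijectivity part already makes \<open>\<Phi> X Y h\<close> composable.\<close>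

lemma adjunction_via_iff:
  assumes F: "covariant_functor C D F" and G: "covariant_functor D C G"
  shows "adjunction_via C D F G \<Phi> \<longleftrightarrow>
     (\<forall>X\<in>Obj C. \<forall>Y\<in>Obj D. bij_betw (\<Phi> X Y) (Hom D (app F X) Y) (Hom C X (app G Y))) \<and>
     (\<forall>f\<in>elts (Mor C). \<forall>g\<in>elts (Mor D). \<forall>h\<in>elts (Mor D).
        src D h = app F (tgt C f) \<longrightarrow> tgt D h = src D g \<longrightarrow>
          \<Phi> (src C f) (tgt D g) (app (Comp D) (opair g (app (Comp D) (opair h (app F f))))) =
          app (Comp C) (opair (app G g) (app (Comp C) (opair (\<Phi> (tgt C f) (src D g) h) f))))"
    (is "_ \<longleftrightarrow> ?bij \<and> ?nat")
proof -
  note C = covariant_functorD(1)[OF F] and D = covariant_functorD(2)[OF F]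
  define N where "N f g h X' X Y Y' \<longleftrightarrow>
      \<Phi> X' Y' (compose D g (compose D h (app F f))) =
      compose C (app G g) (compose C (\<Phi> X Y h) f)" for f g h X' X Y Y'
  have nat: "\<Phi> X' Y' (app (Comp D) (opair g (app (Comp D) (opair h (app F f))))) =
      app (Comp C) (opair (app G g) (app (Comp C) (opair (\<Phi> X Y h) f))) \<longleftrightarrow> N f g h X' X Y Y'"
    if bij: ?bij and f: "f \<in> Hom C X' X" and g: "g \<in> Hom D Y Y'" and h: "h \<in> Hom D (app F X) Y"
    for f g h X X' Y Y'
  proof -
    have k: "\<Phi> X Y h \<in> Hom C X (app G Y)"
      using bij h category_objs(2)[OF C f] category_objs(1)[OF D g] bij_betwE by blast
    note hf = category_compose[OF D h functor_Hom[OF F f]]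
    note kf = category_compose[OF C k f]
    show ?thesis
      unfolding N_def hf(1) kf(1) category_compose(1)[OF D g hf(2), unfolded hf(1)]
        category_compose(1)[OF C functor_Hom[OF G g] kf(2), unfolded kf(1)] ..
  qed
  have "?nat \<longleftrightarrow> (\<forall>X\<in>Obj C. \<forall>X'\<in>Obj C. \<forall>Y\<in>Obj D. \<forall>Y'\<in>Obj D.
      \<forall>f\<in>Hom C X' X. \<forall>g\<in>Hom D Y Y'. \<forall>h\<in>Hom D (app F X) Y. N f g h X' X Y Y')"
    (is "_ \<longleftrightarrow> ?nat'") if bij: ?bij
  proof
    assume n: ?nat
    show ?nat'
    proof (intro ballI)
      fix X X' Y Y' f g h
      assume f: "f \<in> Hom C X' X" and g: "g \<in> Hom D Y Y'" and h: "h \<in> Hom D (app F X) Y"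
      then show "N f g h X' X Y Y'"
        using n nat[OF bij f g h] by (auto simp: Hom_def)
    qed
  next
    assume n: ?nat'
    show ?nat
    proof (intro ballI impI)
      fix f g h
      assume "f \<in> elts (Mor C)" "g \<in> elts (Mor D)" "h \<in> elts (Mor D)"
        "src D h = app F (tgt C f)" "tgt D h = src D g"
      then have f: "f \<in> Hom C (src C f) (tgt C f)" and g: "g \<in> Hom D (src D g) (tgt D g)"
        and h: "h \<in> Hom D (app F (tgt C f)) (src D g)"
        by (auto simp: Hom_def)
      have "N f g h (src C f) (tgt C f) (src D g) (tgt D g)"
        using n f g h category_objs[OF C f] category_objs[OF D g] by blast
      then show "\<Phi> (src C f) (tgt D g) (app (Comp D) (opair g (app (Comp D) (opair h (app F f))))) =
          app (Comp C) (opair (app G g) (app (Comp C) (opair (\<Phi> (tgt C f) (src D g) h) f)))"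
        using nat[OF bij f g h] by blast
    qed
  qed
  then show ?thesis unfolding adjunction_via_def N_def by blast
qed

abbreviation obj_fm :: "'a cat \<Rightarrow> 'a tm \<Rightarrow> 'a fm" where
  "obj_fm C t \<equiv> And (Eq (src_tm C t) t) (Eq (tgt_tm C t) t)"

abbreviation hom_fm :: "'a cat \<Rightarrow> 'a tm \<Rightarrow> 'a tm \<Rightarrow> 'a tm \<Rightarrow> 'a fm" where
  "hom_fm C t u v \<equiv> And (Eq (src_tm C t) u) (Eq (tgt_tm C t) v)"

abbreviation transpose_tm :: "'a \<Rightarrow> 'a tm \<Rightarrow> 'a tm \<Rightarrow> 'a tm \<Rightarrow> 'a tm" where
  "transpose_tm P t u v \<equiv> App (Const P) (tm.Pair (tm.Pair t u) v)"

text \<open>Application of \<open>P\<close> to triples \<open>\<langle>X, Y, h\<rangle>\<close> is a natural family of bijections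
  \<open>Hom\<^sub>D(F X, Y) \<rightarrow> Hom\<^sub>C(X, G Y)\<close>. The first conjunct says, for all objects \<open>X\<close> and \<open>Y\<close>, that the
  map is well defined, injective and surjective; the second is naturality.\<close>

definition adjunction_fm :: "'a cat \<Rightarrow> 'a cat \<Rightarrow> 'a \<Rightarrow> 'a \<Rightarrow> 'a \<Rightarrow> 'a fm" where
  "adjunction_fm C D F G P =
     And (BAll_mor 0 C (Imp (obj_fm C (Var 0)) (BAll_mor 1 D (Imp (obj_fm D (Var 1))
            (And (BAll_mor 2 D (Imp (hom_fm D (Var 2) (App (Const F) (Var 0)) (Var 1))
                    (And (Mem (transpose_tm P (Var 0) (Var 1) (Var 2)) (Const (Mor C)))
                         (hom_fm C (transpose_tm P (Var 0) (Var 1) (Var 2))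
                            (Var 0) (App (Const G) (Var 1))))))
            (And (BAll_mor 2 D (Imp (hom_fm D (Var 2) (App (Const F) (Var 0)) (Var 1))
                    (BAll_mor 3 D (Imp (hom_fm D (Var 3) (App (Const F) (Var 0)) (Var 1))
                       (Imp (Eq (transpose_tm P (Var 0) (Var 1) (Var 2))
                                (transpose_tm P (Var 0) (Var 1) (Var 3)))
                            (Eq (Var 2) (Var 3)))))))
                 (BAll_mor 2 C (Imp (hom_fm C (Var 2) (Var 0) (App (Const G) (Var 1)))
                    (BEx_mor 3 D (And (hom_fm D (Var 3) (App (Const F) (Var 0)) (Var 1))
                       (Eq (transpose_tm P (Var 0) (Var 1) (Var 3)) (Var 2))))))))))))
         (BAll_mor 0 C (BAll_mor 1 D (BAll_mor 2 D
            (Imp (Eq (src_tm D (Var 2)) (App (Const F) (tgt_tm C (Var 0))))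
            (Imp (Eq (tgt_tm D (Var 2)) (src_tm D (Var 1)))
              (Eq (transpose_tm P (src_tm C (Var 0)) (tgt_tm D (Var 1))
                     (compose_tm D (Var 1) (compose_tm D (Var 2) (App (Const F) (Var 0)))))
                  (compose_tm C (App (Const G) (Var 1))
                     (compose_tm C (transpose_tm P (tgt_tm C (Var 0)) (src_tm D (Var 1)) (Var 2))
                        (Var 0)))))))))"

lemma Hom_quantifiers:
  "f \<in> Hom C X Y \<longleftrightarrow> f \<in> elts (Mor C) \<and> src C f = X \<and> tgt C f = Y"
  "(\<forall>f\<in>Hom C X Y. R f) \<longleftrightarrow> (\<forall>f\<in>elts (Mor C). src C f = X \<and> tgt C f = Y \<longrightarrow> R f)"
  "(\<exists>f\<in>Hom C X Y. R f) \<longleftrightarrow> (\<exists>f\<in>elts (Mor C). (src C f = X \<and> tgt C f = Y) \<and> R f)"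
  unfolding Hom_def by blast+

lemma Obj_quantifier:
  "(\<forall>X\<in>Obj C. R X) \<longleftrightarrow> (\<forall>X\<in>elts (Mor C). src C X = X \<and> tgt C X = X \<longrightarrow> R X)"
  unfolding Obj_def by blast

lemma bij_betw_iff_elementwise:
  "bij_betw k A B \<longleftrightarrow> (\<forall>h\<in>A. k h \<in> B) \<and> (\<forall>h\<in>A. \<forall>h'\<in>A. k h = k h' \<longrightarrow> h = h') \<and>
     (\<forall>y\<in>B. \<exists>h\<in>A. k h = y)"
  unfolding bij_betw_def inj_on_def by auto

lemma sat_adjunction_fm:
  assumes "covariant_functor C D F" "covariant_functor D C G"
  shows "sat e (adjunction_fm C D F G P) \<longleftrightarrow>
    adjunction_via C D F G (\<lambda>X Y h. app P (otriple X Y h))"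
  unfolding adjunction_via_iff[OF assms] bij_betw_iff_elementwise Hom_quantifiers Obj_quantifier
    adjunction_fm_def src_def tgt_def otriple_def
  by simp

text \<open>Only the values of \<open>\<Phi> X Y\<close> on \<open>Hom\<^sub>D(F X, Y)\<close> matter.\<close>

lemma adjunction_via_cong:
  assumes "covariant_functor C D F" "covariant_functor D C G"
    and eq: "\<And>X Y h. X \<in> Obj C \<Longrightarrow> Y \<in> Obj D \<Longrightarrow> h \<in> Hom D (app F X) Y \<Longrightarrow> \<Phi> X Y h = \<Psi> X Y h"
    and \<Phi>: "adjunction_via C D F G \<Phi>"
  shows "adjunction_via C D F G \<Psi>"
  unfolding adjunction_via_def
proof (intro conjI ballI)
  fix X Y assume "X \<in> Obj C" "Y \<in> Obj D"
  then show "bij_betw (\<Psi> X Y) (Hom D (app F X) Y) (Hom C X (app G Y))"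
    using \<Phi> bij_betw_cong[of "Hom D (app F X) Y" "\<Phi> X Y" "\<Psi> X Y"] eq
    unfolding adjunction_via_def by blast
next
  fix X X' Y Y' f g h
  assume *: "X \<in> Obj C" "X' \<in> Obj C" "Y \<in> Obj D" "Y' \<in> Obj D"
    "f \<in> Hom C X' X" "g \<in> Hom D Y Y'" "h \<in> Hom D (app F X) Y"
  note D = covariant_functorD(2)[OF assms(1)]
  have "compose D g (compose D h (app F f)) \<in> Hom D (app F X') Y'"
    using category_compose(2)[OF D *(6) category_compose(2)[OF D *(7) functor_Hom[OF assms(1) *(5)]]] .
  moreover have "\<Phi> X' Y' (compose D g (compose D h (app F f))) =
      compose C (app G g) (compose C (\<Phi> X Y h) f)"
    using \<Phi> * unfolding adjunction_via_def by blast
  ultimately show "\<Psi> X' Y' (compose D g (compose D h (app F f))) =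
      compose C (app G g) (compose C (\<Psi> X Y h) f)"
    using eq * by simp
qed

text \<open>Between small categories the family of bijections has a graph in the superstructure.\<close>

lemma transpose_graph_exists:
  assumes S: "base_set S" and C: "Mor C \<in> superstructure S - S" and D: "Mor D \<in> superstructure S - S"
    and \<Phi>: "adjunction_via C D F G \<Phi>"
  obtains P where "P \<in> superstructure S"
    "\<And>X Y h. X \<in> Obj C \<Longrightarrow> Y \<in> Obj D \<Longrightarrow> h \<in> Hom D (app F X) Y \<Longrightarrow> app P (otriple X Y h) = \<Phi> X Y h"
proof -
  obtain m n where "elts (Mor C) \<subseteq> level S m" "elts (Mor D) \<subseteq> level S n"
    using C D superstructure_setE by metis
  then have sub: "elts (Mor C) \<subseteq> level S (max m n)" "elts (Mor D) \<subseteq> level S (max m n)"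
    using level_mono max.cobounded1 max.cobounded2 by blast+
  let ?k = "max m n"
  let ?A = "{opair (otriple X Y h) (\<Phi> X Y h) | X Y h.
    X \<in> Obj C \<and> Y \<in> Obj D \<and> h \<in> Hom D (app F X) Y}"
  have A: "?A \<subseteq> level S (Suc (Suc (?k + 4)))"
  proof clarify
    fix X Y h assume *: "X \<in> Obj C" "Y \<in> Obj D" "h \<in> Hom D (app F X) Y"
    then have "\<Phi> X Y h \<in> Hom C X (app G Y)"
      using \<Phi> bij_betwE unfolding adjunction_via_def by blast
    then have "\<Phi> X Y h \<in> level S (?k + 4)"
      using sub(1) level_mono[of ?k "?k + 4" S] by (auto simp: Hom_def)
    moreover have "otriple X Y h \<in> level S (?k + 4)"
      using * sub by (intro otriple_in_level) (auto simp: Hom_def Obj_def)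
    ultimately show "opair (otriple X Y h) (\<Phi> X Y h) \<in> level S (Suc (Suc (?k + 4)))"
      by (intro opair_in_level)
  qed
  obtain P where P: "is_set P" "elts P = ?A" using bounded_set_exists[OF S A] .
  have "P \<in> superstructure S"
    using bounded_set_in_superstructure[OF S P(1), of "Suc (Suc (?k + 4))"] A P(2) by simp
  moreover have "app P (otriple X Y h) = \<Phi> X Y h"
    if "X \<in> Obj C" "Y \<in> Obj D" "h \<in> Hom D (app F X) Y" for X Y h
    by (rule app_eqI) (use that P(2) in \<open>auto simp: otriple_inject\<close>)
  ultimately show ?thesis using that by blast
qed


section \<open>Enlarging categories, functors and adjunctions\<close>

lemma small_category_parts:
  assumes S: "base_set S" and C: "small_category S C"
  shows "Mor C \<in> superstructure S - S" "Src C \<in> superstructure S - S"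
    "Tgt C \<in> superstructure S - S" "Comp C \<in> superstructure S - S"
proof -
  have cat: "category C" and M: "Mor C \<in> superstructure S - S"
    using C by (auto simp: small_category_def)
  show "Mor C \<in> superstructure S - S" by fact
  show "Src C \<in> superstructure S - S" "Tgt C \<in> superstructure S - S"
    using is_fun_in_superstructure[OF S _ M M] category_components(2,3)[OF cat] by blast+
  obtain n where "elts (Mor C) \<subseteq> level S n" using superstructure_setE[OF M] .
  then have "otriple f g h \<in> level S (n + 4)"
    if "f \<in> elts (Mor C)" "g \<in> elts (Mor C)" "h \<in> elts (Mor C)" for f g h
    using that by (intro otriple_in_level) auto
  then have "elts (Comp C) \<subseteq> level S (n + 4)"
    using category_components(7)[OF cat] by fast
  then show "Comp C \<in> superstructure S - S"
    using bounded_set_in_superstructure[OF S category_components(6)[OF cat]] by blast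
qed

lemma star_cat_sel [simp]:
  "Mor (star_cat star C) = star (Mor C)" "Src (star_cat star C) = star (Src C)"
  "Tgt (star_cat star C) = star (Tgt C)" "Comp (star_cat star C) = star (Comp C)"
  by (simp_all add: star_cat_def)

lemma star_category:
  assumes E: "enlargement S W star" and C: "small_category S C"
  shows "category (star_cat star C)"
proof -
  have S: "base_set S" using E by (simp add: enlargement_def)
  note parts = small_category_parts[OF S C]
  have cat: "category C" using C by (simp add: small_category_def)
  have "map_fm star (category_fm C) = category_fm (star_cat star C)"
    by (simp add: category_fm_def fun_fm_def)
  moreover have "fv_fm (category_fm C) = {}"
    by (auto simp: category_fm_def fun_fm_def)
  moreover have "set_fm (category_fm C) \<subseteq> superstructure S"
    using parts by (simp add: category_fm_def fun_fm_def)
  ultimately have "sat e (category_fm (star_cat star C)) \<longleftrightarrow> sat e (category_fm C)" for e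
    using transfer[OF E, of "category_fm C" e] by simp
  moreover have "sat e (category_fm C)" for e
    using cat sat_category_fm[of C e] category_components[OF cat] by blast
  ultimately show ?thesis
    using sat_category_fm[of "star_cat star C"] star_is_set[OF E] parts by simp
qed

lemma star_functor:
  assumes E: "enlargement S W star" and C: "small_category S C" and D: "small_category S D"
    and F: "covariant_functor C D F"
  shows "covariant_functor (star_cat star C) (star_cat star D) (star F)"
proof -
  have S: "base_set S" using E by (simp add: enlargement_def)
  note parts = small_category_parts[OF S C] small_category_parts[OF S D]
  note cat = covariant_functorD(1,2)[OF F] and fun_F = covariant_functorD(3)[OF F]
  have F': "F \<in> superstructure S - S" using is_fun_in_superstructure[OF S fun_F] parts by blast
  have "map_fm star (functor_fm C D F) = functor_fm (star_cat star C) (star_cat star D) (star F)"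
    by (simp add: functor_fm_def fun_fm_def)
  moreover have "fv_fm (functor_fm C D F) = {}"
    by (auto simp: functor_fm_def fun_fm_def)
  moreover have "set_fm (functor_fm C D F) \<subseteq> superstructure S"
    using parts F' by (simp add: functor_fm_def fun_fm_def)
  moreover have "sat e (functor_fm C D F)" for e
    using F fun_F sat_functor_fm[OF cat] by (simp add: is_fun_def)
  ultimately have "sat e (functor_fm (star_cat star C) (star_cat star D) (star F))" for e
    using transfer[OF E, of "functor_fm C D F" e] by simp
  then show ?thesis
    using sat_functor_fm[OF star_category[OF E C] star_category[OF E D]] star_is_set[OF E F']
    by blast
qed

theorem proposition2p19:
  fixes S W :: "'a::urelement_universe set"
    and star :: "'a \<Rightarrow> 'a"
    and C D :: "'a cat"
    and F G :: 'a
  assumes "enlargement S W star"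
    and "small_category S C" and "small_category S D"
    and "covariant_functor C D F" and "covariant_functor D C G"
    and "left_adjoint C D F G"
  shows "left_adjoint (star_cat star C) (star_cat star D) (star F) (star G)"
proof -
  note E = assms(1) and C = assms(2) and D = assms(3) and F = assms(4) and G = assms(5)
  have S: "base_set S" using E by (simp add: enlargement_def)
  note parts = small_category_parts[OF S C] small_category_parts[OF S D]
  have FG: "F \<in> superstructure S - S" "G \<in> superstructure S - S"
    using covariant_functorD(3)[OF F] covariant_functorD(3)[OF G]
      is_fun_in_superstructure[OF S] parts by blast+
  obtain \<Phi> where \<Phi>: "adjunction_via C D F G \<Phi>"
    using assms(6) unfolding left_adjoint_iff by (elim conjE exE)
  obtain P where P: "P \<in> superstructure S"
    "\<And>X Y h. X \<in> Obj C \<Longrightarrow> Y \<in> Obj D \<Longrightarrow> h \<in> Hom D (app F X) Y \<Longrightarrow> app P (otriple X Y h) = \<Phi> X Y h"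
    using transpose_graph_exists[OF S parts(1,5) \<Phi>] by blast
  have "adjunction_via C D F G (\<lambda>X Y h. app P (otriple X Y h))"
    by (rule adjunction_via_cong[OF F G _ \<Phi>]) (simp add: P(2))
  then have "sat e (adjunction_fm C D F G P)" for e
    using sat_adjunction_fm[OF F G] by blast
  moreover have "map_fm star (adjunction_fm C D F G P) =
      adjunction_fm (star_cat star C) (star_cat star D) (star F) (star G) (star P)"
    by (simp add: adjunction_fm_def)
  moreover have "fv_fm (adjunction_fm C D F G P) = {}"
    by (auto simp: adjunction_fm_def)
  moreover have "set_fm (adjunction_fm C D F G P) \<subseteq> superstructure S"
    using parts FG P(1) by (simp add: adjunction_fm_def)
  ultimately have "sat e
      (adjunction_fm (star_cat star C) (star_cat star D) (star F) (star G) (star P))" for e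
    using transfer[OF E, of "adjunction_fm C D F G P" e] by simp
  then have "adjunction_via (star_cat star C) (star_cat star D) (star F) (star G)
      (\<lambda>X Y h. app (star P) (otriple X Y h))"
    unfolding sat_adjunction_fm[OF star_functor[OF E C D F] star_functor[OF E D C G]] .
  then show ?thesis
    unfolding left_adjoint_iff using star_functor[OF E C D F] star_functor[OF E D C G]
    by (intro conjI exI)
qed

end
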